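(* For any $\mu\in(0,1)$, the Bernoulli distribution with mean $\mu$ is sub-Gaussian with optimal proxy variance $$\sigma_{\text{opt}}^2(\mu)=\frac{1-2\mu}{2\ln\frac{1-\mu}{\mu}},$$ where for $\mu=\frac12$ the right-hand side is understood as its limit $\frac14$.
   Context: A real random variable $X$ with finite mean $m=\mathbb{E}[X]$ is $\sigma^2$-sub-Gaussian if $\mathbb{E}[\exp(\lambda(X-m))]\le\exp(\lambda^2\sigma^2/2)$ for all $\lambda\in\mathbb{R}$; it is sub-Gaussian if this holds for some $\sigma>0$. Its optimal proxy variance is $\min\{\sigma^2\ge 0 : X\text{ is }\sigma^2\text{-sub-Gaussian}\}$. The Bernoulli distribution with mean $\mu$ takes the value $1$ with probability $\mu$ and $0$ with probability $1-\mu$. *)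

theory Defs
  imports "HOL-Probability.Probability"
begin

text \<open>
  The parameter \<open>v\<close> plays the role of \<open>\<sigma>\<^sup>2\<close>. Integrability of the exponential is
  required explicitly, since the Bochner integral of a non-integrable function is \<open>0\<close>,
  so the inequality alone would hold also when the expectation is infinite.
\<close>

definition subgaussian_with :: "'a measure \<Rightarrow> ('a \<Rightarrow> real) \<Rightarrow> real \<Rightarrow> bool" where
  "subgaussian_with M X v \<longleftrightarrow>
     prob_space M \<and> integrable M X \<and>
     (\<forall>l::real.
        integrable M (\<lambda>w. exp (l * (X w - prob_space.expectation M X))) \<and>
        prob_space.expectation M (\<lambda>w. exp (l * (X w - prob_space.expectation M X)))
          \<le> exp (l\<^sup>2 * v / 2))"

definition subgaussian :: "'a measure \<Rightarrow> ('a \<Rightarrow> real) \<Rightarrow> bool" where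
  "subgaussian M X \<longleftrightarrow> (\<exists>s>0. subgaussian_with M X (s\<^sup>2))"

definition proxy_variances :: "'a measure \<Rightarrow> ('a \<Rightarrow> real) \<Rightarrow> real set" where
  "proxy_variances M X = {v. 0 \<le> v \<and> subgaussian_with M X v}"

text \<open>
  A relation rather than a function, so that asserting it includes that the minimum is attained.
\<close>

definition is_optimal_proxy_variance :: "'a measure \<Rightarrow> ('a \<Rightarrow> real) \<Rightarrow> real \<Rightarrow> bool" where
  "is_optimal_proxy_variance M X v \<longleftrightarrow>
     v \<in> proxy_variances M X \<and> (\<forall>u \<in> proxy_variances M X. v \<le> u)"

text \<open>
  The law on the Borel sets of the reals; the library's \<open>bernoulli_pmf\<close> lives on \<open>bool\<close>.
  A random variable with this law is the identity.
\<close>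

definition bernoulli_distribution :: "real \<Rightarrow> real measure" where
  "bernoulli_distribution \<mu> = distr (measure_pmf (bernoulli_pmf \<mu>)) borel of_bool"

definition bernoulli_proxy_formula :: "real \<Rightarrow> real" where
  "bernoulli_proxy_formula \<mu> = (1 - 2 * \<mu>) / (2 * ln ((1 - \<mu>) / \<mu>))"

end

theory Submission
  imports Defs "HOL-Real_Asymp.Real_Asymp"
begin

text \<open>
  With \<open>b = ln ((1 - \<mu>) / \<mu>) / 2\<close> one has \<open>tanh b = 1 - 2 \<mu>\<close>, and the centred moment
  generating function at \<open>l\<close> is \<open>exp (l tanh b / 2) cosh (l / 2 - b) / cosh b\<close>. Writing
  \<open>x = l / 2 - b\<close>, sub-Gaussianity with parameter \<open>tanh b / (4 b)\<close> becomes
  \<open>ln (cosh x) - ln (cosh b) \<le> tanh b / (2 b) (x\<^sup>2 - b\<^sup>2)\<close>, which holds because \<open>tanh t / t\<close>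
  decreases. Equality at \<open>x = b\<close>, that is at \<open>l = 4 b\<close>, shows that the parameter is optimal
  if \<open>b \<noteq> 0\<close>; for \<open>\<mu> = 1 / 2\<close> the bound is the limit \<open>b \<rightarrow> 0\<close>, and optimality is
  read off the second-order expansion at \<open>l = 0\<close>.
\<close>

text \<open>The difference of the sides vanishes at \<open>0\<close> and has derivative
  \<open>2 * (sinh t)\<^sup>2\<close>.\<close>

lemma le_sinh_mult_cosh:
  fixes x :: real
  assumes "0 \<le> x"
  shows "x \<le> sinh x * cosh x"
proof -
  have "\<exists>d. ((\<lambda>t::real. sinh t * cosh t - t) has_real_derivative d) (at t) \<and> 0 \<le> d" for t
    by (intro exI[of _ "2 * (sinh t)\<^sup>2"] conjI)
      (auto intro!: derivative_eq_intros simp: power2_eq_square[symmetric] cosh_square_eq)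
  then have "sinh 0 * cosh 0 - 0 \<le> sinh x * cosh x - x"
    by (intro DERIV_nonneg_imp_nondecreasing[OF assms])
  then show ?thesis by simp
qed

text \<open>The numerator of the derivative reduces to \<open>t - sinh t * cosh t\<close>, whose
  sign is given by \<open>le_sinh_mult_cosh\<close>.\<close>

lemma tanh_div_antimono:
  fixes x y :: real
  assumes "0 < x" "x \<le> y"
  shows "tanh y / y \<le> tanh x / x"
proof (rule DERIV_nonpos_imp_nonincreasing[of x y "\<lambda>t. tanh t / t"])
  show "x \<le> y" by fact
next
  fix t assume "x \<le> t" "t \<le> y"
  then have t: "0 < t" using assms by simp
  have "((\<lambda>t. tanh t / t) has_real_derivative ((1 - tanh t ^ 2) * t - tanh t) / t\<^sup>2) (at t)"
    using t by (auto intro!: derivative_eq_intros simp: power2_eq_square)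
  moreover have "(1 - tanh t ^ 2) * t - tanh t = (t - sinh t * cosh t) / (cosh t)\<^sup>2"
  proof -
    have "1 - tanh t ^ 2 = (cosh t ^ 2 - sinh t ^ 2) / cosh t ^ 2"
      by (simp add: tanh_def power_divide diff_divide_distrib)
    also have "\<dots> = 1 / cosh t ^ 2"
      by (simp only: hyperbolic_pythagoras)
    finally have "(1 - tanh t ^ 2) * t - tanh t = t / cosh t ^ 2 - tanh t" by simp
    also have "\<dots> = (t - sinh t * cosh t) / (cosh t)\<^sup>2"
      by (simp add: tanh_def diff_divide_distrib power2_eq_square)
    finally show ?thesis .
  qed
  moreover have "(t - sinh t * cosh t) / (cosh t)\<^sup>2 / t\<^sup>2 \<le> 0"
    using le_sinh_mult_cosh[of t] t by (simp add: divide_le_0_iff)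
  ultimately show "\<exists>d. ((\<lambda>t. tanh t / t) has_real_derivative d) (at t) \<and> d \<le> 0"
    by metis
qed

text \<open>The function \<open>g\<close> in the proof has derivative
  \<open>t * (tanh t / t - tanh b / b)\<close> for \<open>t > 0\<close>. As
  \<open>tanh t / t\<close> decreases, \<open>g\<close> rises up to \<open>b\<close> and falls
  afterwards, so its maximum over nonnegative arguments is at \<open>b\<close>.\<close>

lemma ln_cosh_le_quadratic_pos:
  fixes b x :: real
  assumes "0 < b" "0 \<le> x"
  shows "ln (cosh x) - ln (cosh b) \<le> tanh b / (2 * b) * (x\<^sup>2 - b\<^sup>2)"
proof -
  define g where "g t = ln (cosh t) - tanh b / (2 * b) * t\<^sup>2" for t
  have deriv: "(g has_real_derivative (tanh t - tanh b / b * t)) (at t)" for t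
    unfolding g_def using assms
    by (auto intro!: derivative_eq_intros simp: tanh_def field_simps)
  have "g x \<le> g b"
  proof (cases "x \<le> b")
    case True
    have "\<exists>d. (g has_real_derivative d) (at t) \<and> 0 \<le> d" if "x \<le> t" "t \<le> b" for t
    proof (cases "t = 0")
      case True
      then show ?thesis using deriv[of t] by auto
    next
      case False
      then have "0 < t" using that assms by simp
      then show ?thesis
        using tanh_div_antimono[of t b] that deriv[of t] by (auto simp: field_simps)
    qed
    then show ?thesis by (rule DERIV_nonneg_imp_nondecreasing[OF True])
  next
    case False
    have "\<exists>d. (g has_real_derivative d) (at t) \<and> d \<le> 0" if "b \<le> t" "t \<le> x" for t
      using tanh_div_antimono[of b t] that deriv[of t] assms by (auto simp: field_simps)
    then show ?thesis using False by (intro DERIV_nonpos_imp_nonincreasing[of b x g]) auto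
  qed
  then show ?thesis by (simp add: g_def algebra_simps)
qed

text \<open>The tangent line at \<open>y = b\<^sup>2\<close> to the concave function \<open>ln (cosh (sqrt y))\<close>.\<close>
lemma ln_cosh_le_quadratic:
  fixes b x :: real
  assumes "b \<noteq> 0"
  shows "ln (cosh x) - ln (cosh b) \<le> tanh b / (2 * b) * (x\<^sup>2 - b\<^sup>2)"
proof -
  \<comment> \<open>Both sides are even in \<open>b\<close> and in \<open>x\<close>.\<close>
  have "tanh \<bar>b\<bar> / (2 * \<bar>b\<bar>) = tanh b / (2 * b)" "cosh \<bar>b\<bar> = cosh b" "cosh \<bar>x\<bar> = cosh x"
    by (simp_all add: abs_if)
  then show ?thesis
    using ln_cosh_le_quadratic_pos[of "\<bar>b\<bar>" "\<bar>x\<bar>"] assms by simp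
qed

text \<open>The moment generating function of the centred variable, which takes the values
  \<open>1 - \<mu>\<close> and \<open>- \<mu>\<close>.\<close>

definition bernoulli_mgf :: "real \<Rightarrow> real \<Rightarrow> real" where
  "bernoulli_mgf \<mu> l = \<mu> * exp (l * (1 - \<mu>)) + (1 - \<mu>) * exp (- l * \<mu>)"

lemma expectation_bernoulli_distribution:
  fixes f :: "real \<Rightarrow> real"
  assumes "0 \<le> \<mu>" "\<mu> \<le> 1" "f \<in> borel_measurable borel"
  shows "integrable (bernoulli_distribution \<mu>) f"
    and "integral\<^sup>L (bernoulli_distribution \<mu>) f = \<mu> * f 1 + (1 - \<mu>) * f 0"
  using assms unfolding bernoulli_distribution_def
  by (auto simp: integrable_distr_eq integral_distr intro!: integrable_measure_pmf_finite)

lemma subgaussian_with_bernoulli_iff: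
  assumes "0 \<le> \<mu>" "\<mu> \<le> 1"
  shows "subgaussian_with (bernoulli_distribution \<mu>) (\<lambda>x. x) v \<longleftrightarrow>
    (\<forall>l. bernoulli_mgf \<mu> l \<le> exp (l\<^sup>2 * v / 2))"
proof -
  have "prob_space (bernoulli_distribution \<mu>)"
    unfolding bernoulli_distribution_def
    by (rule prob_space.prob_space_distr) (auto intro: measure_pmf.prob_space_axioms)
  then show ?thesis
    using assms
    by (simp add: subgaussian_with_def expectation_bernoulli_distribution bernoulli_mgf_def)
qed

text \<open>The choice of \<open>b\<close> makes \<open>\<mu>\<close> and \<open>1 - \<mu>\<close>
  equal to \<open>exp (- b)\<close> and \<open>exp b\<close> divided by \<open>2 * cosh b\<close>.
  The two exponents of the numerator then lie symmetrically about
  \<open>l * (1 - 2 * \<mu>) / 2\<close>, at distance \<open>l / 2 - b\<close>, and pair up to a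
  cosh.\<close>

lemma bernoulli_mgf_eq_cosh:
  assumes "0 < \<mu>" "\<mu> < 1"
  defines "b \<equiv> ln ((1 - \<mu>) / \<mu>) / 2"
  shows "tanh b = 1 - 2 * \<mu>"
    and "bernoulli_mgf \<mu> l = exp (l * (1 - 2 * \<mu>) / 2) * cosh (l / 2 - b) / cosh b"
proof -
  have "exp (2 * b) = (1 - \<mu>) / \<mu>" using assms by simp
  then have "exp b * exp b = (1 - \<mu>) / \<mu>" by (simp flip: exp_add)
  then have \<mu>: "\<mu> * (exp b + exp (- b)) = exp (- b)"
    using assms by (simp add: exp_minus field_simps)
  then have \<mu>': "(1 - \<mu>) * (exp b + exp (- b)) = exp b" by (simp add: algebra_simps)
  have c: "cosh b \<noteq> 0" by simp
  have "exp b + exp (- b) = 2 * cosh b" by (simp add: cosh_field_def)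
  with \<mu> \<mu>' have c1: "\<mu> * (2 * cosh b) = exp (- b)" "(1 - \<mu>) * (2 * cosh b) = exp b"
    by simp_all
  have "2 * sinh b = (1 - \<mu>) * (2 * cosh b) - \<mu> * (2 * cosh b)"
    unfolding c1 by (simp add: sinh_field_def)
  then have "sinh b = (1 - 2 * \<mu>) * cosh b" by (simp add: algebra_simps)
  then show "tanh b = 1 - 2 * \<mu>" using c by (simp add: tanh_def)
  have "bernoulli_mgf \<mu> l * (2 * cosh b)
      = exp (- b) * exp (l * (1 - \<mu>)) + exp b * exp (- l * \<mu>)"
    unfolding bernoulli_mgf_def c1[symmetric] by (simp add: algebra_simps)
  also have "\<dots> = exp (- b + l * (1 - \<mu>)) + exp (b + - l * \<mu>)"
    by (simp only: exp_add)
  also have "- b + l * (1 - \<mu>) = l * (1 - 2 * \<mu>) / 2 + (l / 2 - b)"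
    by (simp add: field_simps)
  also have "b + - l * \<mu> = l * (1 - 2 * \<mu>) / 2 + - (l / 2 - b)"
    by (simp add: field_simps)
  also have "exp (l * (1 - 2 * \<mu>) / 2 + (l / 2 - b)) + exp (l * (1 - 2 * \<mu>) / 2 + - (l / 2 - b))
      = exp (l * (1 - 2 * \<mu>) / 2) * (2 * cosh (l / 2 - b))"
    unfolding exp_add cosh_field_def by (simp add: algebra_simps)
  finally show "bernoulli_mgf \<mu> l = exp (l * (1 - 2 * \<mu>) / 2) * cosh (l / 2 - b) / cosh b"
    by (simp add: eq_divide_eq)
qed

lemma ln_odds_eq_0_iff:
  fixes \<mu> :: real
  assumes "0 < \<mu>" "\<mu> < 1"
  shows "ln ((1 - \<mu>) / \<mu>) = 0 \<longleftrightarrow> \<mu> = 1 / 2"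
  using assms by (auto simp: field_simps)

lemma bernoulli_mgf_le:
  assumes "0 < \<mu>" "\<mu> < 1" "\<mu> \<noteq> 1 / 2"
  shows "bernoulli_mgf \<mu> l \<le> exp (l\<^sup>2 * bernoulli_proxy_formula \<mu> / 2)"
proof -
  define b where "b = ln ((1 - \<mu>) / \<mu>) / 2"
  have b: "b \<noteq> 0" using ln_odds_eq_0_iff assms by (simp add: b_def)
  have tb: "tanh b = 1 - 2 * \<mu>"
    using bernoulli_mgf_eq_cosh(1) assms by (simp add: b_def)
  have v: "bernoulli_proxy_formula \<mu> = tanh b / (4 * b)"
    unfolding bernoulli_proxy_formula_def tb by (simp add: b_def)
  have "bernoulli_mgf \<mu> l = exp (l * tanh b / 2 + (ln (cosh (l / 2 - b)) - ln (cosh b)))"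
    using bernoulli_mgf_eq_cosh(2)[of \<mu> l] assms
    by (simp add: tb exp_add exp_diff flip: b_def)
  also have "\<dots> \<le> exp (l * tanh b / 2 + tanh b / (2 * b) * ((l / 2 - b)\<^sup>2 - b\<^sup>2))"
    using ln_cosh_le_quadratic[OF b, of "l / 2 - b"] by simp
  \<comment> \<open>Since \<open>(l / 2 - b)\<^sup>2 - b\<^sup>2 = l\<^sup>2 / 4 - l * b\<close>,
    the terms linear in \<open>l\<close> cancel.\<close>
  also have "l * tanh b / 2 + tanh b / (2 * b) * ((l / 2 - b)\<^sup>2 - b\<^sup>2)
      = l\<^sup>2 * bernoulli_proxy_formula \<mu> / 2"
    unfolding v using b by (simp add: field_simps power2_eq_square)
  finally show ?thesis .
qed

text \<open>Here \<open>l / 2 - b = b\<close>, so the two cosh factors cancel. This is the point of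
  contact that rules out any smaller parameter.\<close>

lemma bernoulli_mgf_eq:
  assumes "0 < \<mu>" "\<mu> < 1" "\<mu> \<noteq> 1 / 2"
  defines "l \<equiv> 2 * ln ((1 - \<mu>) / \<mu>)"
  shows "l \<noteq> 0" and "bernoulli_mgf \<mu> l = exp (l\<^sup>2 * bernoulli_proxy_formula \<mu> / 2)"
proof -
  define a where "a = ln ((1 - \<mu>) / \<mu>)"
  have a: "a \<noteq> 0" using ln_odds_eq_0_iff assms by (simp add: a_def)
  then show "l \<noteq> 0" by (simp add: l_def a_def)
  have "bernoulli_mgf \<mu> l = exp (a * (1 - 2 * \<mu>))"
    using bernoulli_mgf_eq_cosh(2)[of \<mu> l] assms(1-3)
    by (simp add: l_def flip: a_def)
  also have "a * (1 - 2 * \<mu>) = l\<^sup>2 * bernoulli_proxy_formula \<mu> / 2"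
    using a by (simp add: l_def bernoulli_proxy_formula_def power2_eq_square flip: a_def)
  finally show "bernoulli_mgf \<mu> l = exp (l\<^sup>2 * bernoulli_proxy_formula \<mu> / 2)" .
qed

lemma bernoulli_mgf_half: "bernoulli_mgf (1 / 2) l = cosh (l / 2)"
  by (simp add: bernoulli_mgf_def cosh_field_def)

text \<open>Let \<open>b\<close> tend to \<open>0\<close> from the right in
  \<open>ln_cosh_le_quadratic\<close>: the slope \<open>tanh b / (2 * b)\<close> tends to
  \<open>1 / 2\<close> and \<open>ln (cosh b)\<close> to \<open>0\<close>.\<close>

lemma cosh_le_exp_square:
  fixes x :: real
  shows "cosh x \<le> exp (x\<^sup>2 / 2)"
proof -
  have "ln (cosh x) \<le> x\<^sup>2 / 2"
  proof (rule tendsto_le)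
    show "((\<lambda>b. tanh b / (2 * b) * (x\<^sup>2 - b\<^sup>2)) \<longlongrightarrow> x\<^sup>2 / 2) (at_right 0)"
      unfolding tanh_def sinh_field_def cosh_field_def by real_asymp
    show "((\<lambda>b. ln (cosh x) - ln (cosh b)) \<longlongrightarrow> ln (cosh x)) (at_right 0)"
      by (auto intro!: tendsto_eq_intros)
    show "\<forall>\<^sub>F b in at_right 0. ln (cosh x) - ln (cosh b) \<le> tanh b / (2 * b) * (x\<^sup>2 - b\<^sup>2)"
      using eventually_at_right_less by eventually_elim (rule ln_cosh_le_quadratic, simp)
  qed simp
  then show ?thesis by (metis cosh_real_pos exp_ln exp_le_cancel_iff)
qed

text \<open>For \<open>\<mu> = 1 / 2\<close> the contact point merges with \<open>l = 0\<close>, so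
  second-order terms are compared instead: \<open>v / 2\<close> for the exponential against
  \<open>1 / 8\<close> for \<open>cosh (l / 2)\<close>.\<close>

lemma quarter_le_if_bernoulli_mgf_half_le:
  assumes "\<And>l. bernoulli_mgf (1 / 2) l \<le> exp (l\<^sup>2 * v / 2)"
  shows "1 / 4 \<le> v"
proof -
  have "0 \<le> v / 2 - 1 / 8"
  proof (rule tendsto_lowerbound)
    show "((\<lambda>l. (exp (l\<^sup>2 * v / 2) - cosh (l / 2)) / l\<^sup>2) \<longlongrightarrow> v / 2 - 1 / 8) (at_right 0)"
      unfolding cosh_field_def by real_asymp
    show "\<forall>\<^sub>F l in at_right 0. 0 \<le> (exp (l\<^sup>2 * v / 2) - cosh (l / 2)) / l\<^sup>2"
      using assms by (simp add: bernoulli_mgf_half)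
  qed simp
  then show ?thesis by simp
qed

lemma bernoulli_proxy_formula_tendsto_half: "(bernoulli_proxy_formula \<longlongrightarrow> 1 / 4) (at (1 / 2))"
  unfolding bernoulli_proxy_formula_def by real_asymp

theorem theorem2:
  fixes \<mu> :: real
  assumes "0 < \<mu>" and "\<mu> < 1"
  shows "subgaussian (bernoulli_distribution \<mu>) (\<lambda>x. x) \<and>
    is_optimal_proxy_variance (bernoulli_distribution \<mu>) (\<lambda>x. x)
      (if \<mu> = 1 / 2 then 1 / 4 else bernoulli_proxy_formula \<mu>) \<and>
    (bernoulli_proxy_formula \<longlongrightarrow> 1 / 4) (at (1 / 2))"
proof -
  define v where "v = (if \<mu> = 1 / 2 then 1 / 4 else bernoulli_proxy_formula \<mu>)"
  have sg: "subgaussian_with (bernoulli_distribution \<mu>) (\<lambda>x. x) u \<longleftrightarrow>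
      (\<forall>l. bernoulli_mgf \<mu> l \<le> exp (l\<^sup>2 * u / 2))" for u
    using assms by (simp add: subgaussian_with_bernoulli_iff)
  have upper: "subgaussian_with (bernoulli_distribution \<mu>) (\<lambda>x. x) v"
    unfolding sg
  proof
    fix l
    show "bernoulli_mgf \<mu> l \<le> exp (l\<^sup>2 * v / 2)"
    proof (cases "\<mu> = 1 / 2")
      case True
      then show ?thesis
        unfolding v_def True bernoulli_mgf_half
        using cosh_le_exp_square[of "l / 2"] by (simp add: power_divide)
    next
      case False
      then show ?thesis using bernoulli_mgf_le assms by (simp add: v_def)
    qed
  qed
  have lower: "v \<le> u" if "subgaussian_with (bernoulli_distribution \<mu>) (\<lambda>x. x) u" for u
  proof (cases "\<mu> = 1 / 2")
    case True
    then have "1 / 4 \<le> u" using that quarter_le_if_bernoulli_mgf_half_le[of u] unfolding sg by blast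
    then show ?thesis using True by (simp add: v_def)
  next
    case False
    define l where "l = 2 * ln ((1 - \<mu>) / \<mu>)"
    have "l \<noteq> 0" "bernoulli_mgf \<mu> l = exp (l\<^sup>2 * v / 2)"
      using bernoulli_mgf_eq[of \<mu>] assms False by (simp_all add: l_def v_def)
    moreover have "bernoulli_mgf \<mu> l \<le> exp (l\<^sup>2 * u / 2)" using that sg by blast
    \<comment> \<open>Compare the exponents and cancel \<open>l\<^sup>2 > 0\<close>.\<close>
    ultimately show ?thesis by simp
  qed
  \<comment> \<open>Off \<open>1 / 2\<close>, the factors \<open>1 - 2 * \<mu>\<close> and
    \<open>ln ((1 - \<mu>) / \<mu>)\<close> have the same sign. Strict positivity makes
    \<open>sqrt v\<close> an admissible witness for \<open>subgaussian\<close>.\<close>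
  have pos: "0 < v"
    using assms ln_odds_eq_0_iff[of \<mu>]
    by (auto simp: v_def bernoulli_proxy_formula_def zero_less_divide_iff ln_div)
  have "subgaussian (bernoulli_distribution \<mu>) (\<lambda>x. x)"
    unfolding subgaussian_def using upper pos by (intro exI[of _ "sqrt v"]) simp
  moreover have "is_optimal_proxy_variance (bernoulli_distribution \<mu>) (\<lambda>x. x) v"
    using upper lower pos by (simp add: is_optimal_proxy_variance_def proxy_variances_def)
  ultimately show ?thesis
    using bernoulli_proxy_formula_tendsto_half by (simp add: v_def)
qed

end
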